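(* If $G\subsetneq\mathbb{R}^n$ is a domain such that $s_G(x,y)=p_G(x,y)$ holds for all $x,y\in G$, then $G$ is a half-space.
   Context: A domain is a non-empty open connected set. For a domain $G\subsetneq\mathbb{R}^n$ and $x\in G$, $d_G(x)=\inf\{|x-z| : z\in\partial G\}$. The triangular ratio metric is $$s_G(x,y)=\frac{|x-y|}{\inf_{z\in\partial G}(|x-z|+|z-y|)},\quad x,y\in G,$$ and the point pair function is $$p_G(x,y)=\frac{|x-y|}{\sqrt{|x-y|^2+4d_G(x)d_G(y)}},\quad x,y\in G.$$ *)

theory Defs
  imports "HOL-Analysis.Analysis"
begin

definition is_domain :: "'a::topological_space set \<Rightarrow> bool" where
  "is_domain G \<longleftrightarrow> G \<noteq> {} \<and> open G \<and> connected G"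

text \<open>The infima below run over the boundary (\<^const>\<open>frontier\<close>) of \<open>G\<close>, which is non-empty
  for every domain \<open>G\<close> other than the whole space.\<close>

definition bdist :: "'a::real_normed_vector set \<Rightarrow> 'a \<Rightarrow> real" where
  "bdist G x = (INF z\<in>frontier G. norm (x - z))"

definition triangular_ratio :: "'a::real_normed_vector set \<Rightarrow> 'a \<Rightarrow> 'a \<Rightarrow> real" where
  "triangular_ratio G x y =
     norm (x - y) / (INF z\<in>frontier G. norm (x - z) + norm (z - y))"

definition point_pair :: "'a::real_normed_vector set \<Rightarrow> 'a \<Rightarrow> 'a \<Rightarrow> real" where
  "point_pair G x y =
     norm (x - y) / sqrt ((norm (x - y))\<^sup>2 + 4 * bdist G x * bdist G y)"

text \<open>Open half-spaces; a domain is open, so this is the relevant notion.\<close>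

definition is_half_space :: "'a::real_inner set \<Rightarrow> bool" where
  "is_half_space H \<longleftrightarrow> (\<exists>a b. a \<noteq> 0 \<and> H = {x. inner a x > b})"

end

theory Submission
  imports Defs
begin

text \<open>Write \<open>d\<close> for the distance to the boundary. The hypothesis says that
  \<open>(|x - z| + |z - y|)\<^sup>2 \<ge> |x - y|\<^sup>2 + 4 d(x) d(y)\<close> for all boundary points \<open>z\<close>, with equality
  for some \<open>z\<close>. Taking for \<open>z\<close> a boundary point nearest to the midpoint \<open>m\<close> of \<open>x\<close> and \<open>y\<close> and
  using the parallelogram law, one gets \<open>d(x) d(y) \<le> d(m)\<^sup>2\<close>. Thus no midpoint lies on the
  boundary, so \<open>G\<close> is midpoint convex because \<open>G \<times> G\<close> is connected, and even convex.

  If \<open>z\<close> now attains equality, let \<open>J\<close> be a half-space containing \<open>G\<close> that is supported at \<open>z\<close>, and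
  \<open>l\<close> the distance to its boundary. Reflection in that hyperplane gives
  \<open>(|x - z| + |z - y|)\<^sup>2 \<ge> |x - y|\<^sup>2 + 4 l(x) l(y)\<close>, while \<open>l \<ge> d\<close> on \<open>G\<close>; hence \<open>l(x) = d(x)\<close> and
  \<open>l(y) = d(y)\<close>. Fix \<open>x\<close> with a unique nearest boundary point. Then \<open>J\<close> does not depend on \<open>y\<close>, so
  \<open>d = l\<close> on all of \<open>G\<close>, which forces \<open>G = J\<close>.\<close>

section \<open>Convexity from midpoints and a reflection inequality\<close>

text \<open>On a segment, the parameters \<open>T\<close> of the points in \<open>S\<close> form a
  closed set. A parameter outside it would lie in a gap whose ends belong to \<open>T\<close>, but
  the mean of these ends lies both in the gap and in \<open>T\<close>.\<close>

lemma closed_midpoint_imp_convex: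
  fixes S :: "'a::real_normed_vector set"
  assumes "closed S"
    and mid: "\<And>x y. x \<in> S \<Longrightarrow> y \<in> S \<Longrightarrow> midpoint x y \<in> S"
  shows "convex S"
proof (rule convexI)
  fix x y and u v :: real
  assume x: "x \<in> S" and y: "y \<in> S" and uv: "0 \<le> u" "0 \<le> v" "u + v = 1"
  define g where "g = (\<lambda>t::real. x + t *\<^sub>R (y - x))"
  define T where "T = {0..1} \<inter> g -` S"
  have "continuous_on UNIV g"
    unfolding g_def by (intro continuous_intros)
  then have clT: "closed T"
    unfolding T_def using assms(1) by (intro closed_Int) (auto intro: closed_vimage)
  have T01: "0 \<in> T" "1 \<in> T"
    using x y by (auto simp: T_def g_def)
  have g_mid: "g ((s + t) / 2) = midpoint (g s) (g t)" for s t
  proof -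
    have "2 *\<^sub>R g ((s + t) / 2) = g s + g t"
      by (simp add: g_def scaleR_add_right scaleR_2 add_divide_distrib flip: scaleR_add_left)
    then have "midpoint (g s) (g t) = inverse 2 *\<^sub>R 2 *\<^sub>R g ((s + t) / 2)"
      by (simp only: midpoint_def)
    then show ?thesis by simp
  qed
  have T_mid: "(s + t) / 2 \<in> T" if "s \<in> T" "t \<in> T" for s t
    using that mid[of "g s" "g t"] by (auto simp: T_def g_mid)
  have "v \<in> T"
  proof (rule ccontr)
    assume v: "v \<notin> T"
    define A where "A = T \<inter> {0..v}"
    define B where "B = T \<inter> {v..1}"
    have "compact A" "compact B"
      unfolding A_def B_def using clT by (auto intro: closed_Int_compact)
    moreover have "A \<noteq> {}" "B \<noteq> {}"
      unfolding A_def B_def using T01 uv by auto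
    ultimately obtain a b where a: "a \<in> A" "\<forall>t\<in>A. t \<le> a" and b: "b \<in> B" "\<forall>t\<in>B. b \<le> t"
      by (meson compact_attains_inf compact_attains_sup)
    have "a \<noteq> v" "b \<noteq> v" using a b v by (auto simp: A_def B_def)
    then have ab: "a < v" "v < b" using a b by (auto simp: A_def B_def)
    have m: "(a + b) / 2 \<in> T" using a b by (auto simp: A_def B_def intro: T_mid)
    moreover have "0 \<le> a" "b \<le> 1" using a b by (auto simp: A_def B_def)
    ultimately have "(a + b) / 2 \<in> A \<or> (a + b) / 2 \<in> B"
      using ab by (auto simp: A_def B_def)
    then show False using a b ab by fastforce
  qed
  then have "g v \<in> S" by (simp add: T_def)
  moreover have u: "u = 1 - v" using uv by simp
  have "g v = u *\<^sub>R x + v *\<^sub>R y" unfolding u g_def by (simp add: algebra_simps)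
  ultimately show "u *\<^sub>R x + v *\<^sub>R y \<in> S" by simp
qed

text \<open>This amounts to the triangle inequality for \<open>v\<close> and the mirror image
  \<open>- w\<close> of \<open>u\<close> in the hyperplane orthogonal to \<open>a\<close>: the
  left-hand side is their squared distance.\<close>

lemma reflection_bound:
  fixes a u v :: "'a::real_inner"
  assumes "norm a = 1"
  shows "(norm (u - v))\<^sup>2 + 4 * (a \<bullet> u) * (a \<bullet> v) \<le> (norm u + norm v)\<^sup>2"
proof -
  define w where "w = (2 * (a \<bullet> u)) *\<^sub>R a - u"
  have aa: "a \<bullet> a = 1" using assms by (simp add: norm_eq_1)
  have "w \<bullet> w = u \<bullet> u"
    by (simp add: w_def aa inner_commute algebra_simps)
  then have "norm w = norm u" by (simp add: norm_eq_sqrt_inner)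
  moreover have "w \<bullet> v \<le> norm w * norm v" by (rule norm_cauchy_schwarz)
  moreover have "w \<bullet> v = 2 * (a \<bullet> u) * (a \<bullet> v) - u \<bullet> v"
    by (simp add: w_def inner_diff_left)
  ultimately have "2 * (a \<bullet> u) * (a \<bullet> v) - u \<bullet> v \<le> norm u * norm v" by simp
  moreover have "(norm (u - v))\<^sup>2 = (norm u)\<^sup>2 + (norm v)\<^sup>2 - 2 * (u \<bullet> v)"
    by (simp add: power2_norm_eq_inner inner_diff_left inner_diff_right inner_commute)
  moreover have "(norm u + norm v)\<^sup>2 = (norm u)\<^sup>2 + (norm v)\<^sup>2 + 2 * (norm u * norm v)"
    by (simp add: power2_sum)
  ultimately show ?thesis by linarith
qed

section \<open>Distances to the boundary\<close>

lemma bdist_eq_infdist: "frontier G \<noteq> {} \<Longrightarrow> bdist G x = infdist x (frontier G)"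
  by (simp add: bdist_def infdist_notempty dist_norm)

lemma infdist_frontier_pos:
  assumes "open G" "frontier G \<noteq> {}" "x \<in> G"
  shows "0 < infdist x (frontier G)"
proof -
  have "x \<notin> frontier G" using assms by (simp add: frontier_def interior_open)
  then show ?thesis using assms(2) by (simp add: infdist_pos_not_in_closed)
qed

lemma infdist_frontier_le:
  fixes G :: "'a::real_normed_vector set"
  assumes "x \<in> G" "p \<notin> G"
  shows "infdist x (frontier G) \<le> norm (x - p)"
proof -
  obtain w where w: "w \<in> closed_segment x p" "w \<in> frontier G"
    using connected_Int_frontier[of "closed_segment x p" G] assms by auto
  have "infdist x (frontier G) \<le> dist x w" using w(2) by (rule infdist_le)
  also have "\<dots> \<le> dist x p"
    using segment_bound(1)[OF w(1)] by (simp add: dist_norm norm_minus_commute)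
  finally show ?thesis by (simp add: dist_norm)
qed

lemma sum_dist_attains_inf:
  fixes F :: "'a::heine_borel set"
  assumes "closed F" "F \<noteq> {}"
  obtains z where "z \<in> F" "\<And>w. w \<in> F \<Longrightarrow> dist x z + dist z y \<le> dist x w + dist w y"
proof -
  obtain z0 where z0: "z0 \<in> F" using assms by auto
  \<comment> \<open>Outside this ball the distance to \<open>x\<close> alone exceeds the sum at
    \<open>z0\<close>, so minimising over the compact \<open>K\<close> suffices.\<close>
  define K where "K = F \<inter> cball x (dist x z0 + dist z0 y)"
  have "compact K" unfolding K_def using assms by (auto intro: closed_Int_compact)
  moreover have "z0 \<in> K" using z0 by (simp add: K_def)
  moreover have "continuous_on K (\<lambda>z. dist x z + dist z y)" by (intro continuous_intros)
  ultimately obtain z where z: "z \<in> K" "\<And>w. w \<in> K \<Longrightarrow> dist x z + dist z y \<le> dist x w + dist w y"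
    using continuous_attains_inf[of K "\<lambda>z. dist x z + dist z y"] by auto
  show thesis
  proof
    show "z \<in> F" using z by (simp add: K_def)
    fix w assume w: "w \<in> F"
    show "dist x z + dist z y \<le> dist x w + dist w y"
    proof (cases "w \<in> K")
      case False
      then have "dist x z0 + dist z0 y < dist x w" using w by (simp add: K_def)
      then show ?thesis using z(2)[OF \<open>z0 \<in> K\<close>] zero_le_dist[of w y] by linarith
    qed (use z in auto)
  qed
qed

text \<open>Since \<open>x \<noteq> y\<close>, the equal numerators cancel and the denominators
  agree; squaring removes the root. The infimum is attained, which supplies the extremal
  \<open>z\<close>.\<close>

lemma triangular_ratio_eq_point_pairD:
  fixes G :: "'a::euclidean_space set"
  assumes eq: "triangular_ratio G x y = point_pair G x y" and ne: "x \<noteq> y" "frontier G \<noteq> {}"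
  defines "c \<equiv> (norm (x - y))\<^sup>2 + 4 * infdist x (frontier G) * infdist y (frontier G)"
  shows "\<And>w. w \<in> frontier G \<Longrightarrow> c \<le> (norm (x - w) + norm (w - y))\<^sup>2"
    and "\<exists>z\<in>frontier G. (norm (x - z) + norm (z - y))\<^sup>2 = c"
proof -
  obtain z where z: "z \<in> frontier G"
      "\<And>w. w \<in> frontier G \<Longrightarrow> norm (x - z) + norm (z - y) \<le> norm (x - w) + norm (w - y)"
    using sum_dist_attains_inf[of "frontier G" x y] ne by (auto simp: dist_norm)
  have "(INF w\<in>frontier G. norm (x - w) + norm (w - y)) = norm (x - z) + norm (z - y)"
    using z by (intro cInf_eq_minimum) auto
  then have "norm (x - z) + norm (z - y) = sqrt c"
    using eq ne by (simp add: triangular_ratio_def point_pair_def bdist_eq_infdist c_def)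
  moreover have "0 \<le> c" by (simp add: c_def infdist_nonneg)
  ultimately have c: "(norm (x - z) + norm (z - y))\<^sup>2 = c" by simp
  then show "\<exists>z\<in>frontier G. (norm (x - z) + norm (z - y))\<^sup>2 = c" using z by auto
  fix w assume "w \<in> frontier G"
  then show "c \<le> (norm (x - w) + norm (w - y))\<^sup>2"
    unfolding c[symmetric] using z by (intro power_mono) auto
qed

section \<open>Convexity of the domain\<close>

text \<open>The square of a sum is at most twice the sum of squares, which the parallelogram law
  rewrites using \<open>u + v\<close>, twice the vector from \<open>z\<close> to the
  midpoint.\<close>

lemma sum_dist_midpoint_bound:
  fixes x y z :: "'a::real_inner"
  shows "(norm (x - z) + norm (z - y))\<^sup>2 \<le> (norm (x - y))\<^sup>2 + 4 * (dist (midpoint x y) z)\<^sup>2"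
proof -
  define u v where "u = x - z" and "v = y - z"
  have "(norm u + norm v)\<^sup>2 \<le> 2 * ((norm u)\<^sup>2 + (norm v)\<^sup>2)"
    using sum_squares_ge_zero[of "norm u - norm v" 0] by (simp add: power2_eq_square algebra_simps)
  moreover have "2 * ((norm u)\<^sup>2 + (norm v)\<^sup>2) = (norm (u - v))\<^sup>2 + (norm (u + v))\<^sup>2"
    by (simp add: power2_norm_eq_inner inner_diff_left inner_diff_right inner_add_left
        inner_add_right inner_commute)
  moreover have "norm (u + v) = 2 * dist (midpoint x y) z"
  proof -
    have "u + v = 2 *\<^sub>R (midpoint x y - z)"
      by (simp add: u_def v_def midpoint_def scaleR_right_diff_distrib scaleR_2)
    then show ?thesis by (simp add: dist_norm)
  qed
  ultimately show ?thesis by (simp add: u_def v_def norm_minus_commute power_mult_distrib)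
qed

lemma convex_if_infdist_midpoint:
  fixes G :: "'a::euclidean_space set"
  assumes G: "open G" "connected G"
    and mid: "\<And>x y. x \<in> G \<Longrightarrow> y \<in> G \<Longrightarrow>
      infdist x (frontier G) * infdist y (frontier G) \<le> (infdist (midpoint x y) (frontier G))\<^sup>2"
  shows "convex G"
proof (cases "frontier G = {}")
  case True
  then show ?thesis by (auto simp: frontier_eq_empty)
next
  case ne: False
  let ?d = "\<lambda>x. infdist x (frontier G)"
  note pos = infdist_frontier_pos[OF G(1) ne]
  have midG: "midpoint x y \<in> G" if "x \<in> G" "y \<in> G" for x y
  proof -
    \<comment> \<open>The set of all midpoints is connected, meets \<open>G\<close> and, by
      \<open>mid\<close> and positivity of the distance, misses the frontier; so it stays in
      \<open>G\<close>.\<close>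
    define M where "M = (\<lambda>(x, y). midpoint x y) ` (G \<times> G)"
    have "connected M"
      unfolding M_def midpoint_def split_def using G(2)
      by (intro connected_continuous_image continuous_intros connected_Times)
    moreover have "M \<inter> frontier G = {}"
    proof -
      have "midpoint a b \<notin> frontier G" if "a \<in> G" "b \<in> G" for a b
        using mult_pos_pos[OF pos[OF that(1)] pos[OF that(2)]] mid[OF that] by auto
      then show ?thesis by (auto simp: M_def)
    qed
    moreover have "x \<in> M \<inter> G"
      using that by (auto simp: M_def image_iff intro!: bexI[of _ x])
    ultimately have "M \<subseteq> G" using connected_Int_frontier[of M G] by blast
    then show ?thesis using that by (auto simp: M_def)
  qed
  show ?thesis
  proof (rule convexI)
    fix x y and u v :: real
    assume x: "x \<in> G" and y: "y \<in> G" and uv: "0 \<le> u" "0 \<le> v" "u + v = 1"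
    \<comment> \<open>The criterion for closed sets is applied not to \<open>G\<close> but to a
      superlevel set \<open>S\<close> of the distance that contains \<open>x\<close> and
      \<open>y\<close>. As \<delta> is positive, \<open>S\<close> avoids the frontier and lies in
      \<open>G\<close>.\<close>
    define \<delta> where "\<delta> = min (?d x) (?d y)"
    define S where "S = closure G \<inter> {w. \<delta> \<le> ?d w}"
    have \<delta>: "0 < \<delta>" using pos x y by (simp add: \<delta>_def)
    have SG: "w \<in> G" if "w \<in> S" for w
      using that \<delta> closure_Un_frontier[of G] by (auto simp: S_def)
    have "convex S"
    proof (rule closed_midpoint_imp_convex)
      show "closed S"
        unfolding S_def by (intro closed_Int closed_closure closed_Collect_le continuous_intros)
      fix a b assume ab: "a \<in> S" "b \<in> S"
      then have "\<delta>\<^sup>2 \<le> ?d a * ?d b"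
        using \<delta> by (auto simp: S_def power2_eq_square intro!: mult_mono)
      also have "\<dots> \<le> (?d (midpoint a b))\<^sup>2" using mid SG ab by blast
      finally have "\<delta> \<le> ?d (midpoint a b)" using infdist_nonneg power2_le_imp_le by blast
      then show "midpoint a b \<in> S"
        using midG[OF SG SG] ab closure_subset by (auto simp: S_def)
    qed
    moreover have "x \<in> S" "y \<in> S"
      using x y closure_subset by (auto simp: S_def \<delta>_def)
    ultimately have "u *\<^sub>R x + v *\<^sub>R y \<in> S" using uv by (simp add: convexD)
    then show "u *\<^sub>R x + v *\<^sub>R y \<in> G" by (rule SG)
  qed
qed

section \<open>Half-spaces and the distance function\<close>

text \<open>Positivity of the distance puts \<open>G\<close> into the open half-space
  \<open>J\<close>. If \<open>J\<close> were larger, being connected it would contain a frontier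
  point of \<open>G\<close>, where the distance vanishes but, by continuity, equals the positive
  affine expression.\<close>

lemma half_space_if_infdist_affine:
  fixes G :: "'a::euclidean_space set"
  assumes "open G" "G \<noteq> {}" "frontier G \<noteq> {}" "e \<noteq> 0"
    and d: "\<And>y. y \<in> G \<Longrightarrow> infdist y (frontier G) = e \<bullet> (y - z)"
  shows "is_half_space G"
proof -
  define J where "J = {y. e \<bullet> y > e \<bullet> z}"
  have "G \<subseteq> J"
  proof
    fix y assume y: "y \<in> G"
    then have "0 < infdist y (frontier G)"
      using infdist_frontier_pos assms(1,3) by blast
    then show "y \<in> J" using d[OF y] by (simp add: J_def inner_diff_right)
  qed
  moreover have "J \<subseteq> G"
  proof (rule ccontr)
    assume "\<not> J \<subseteq> G"
    moreover have "connected J"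
      unfolding J_def by (intro convex_connected convex_halfspace_gt)
    ultimately obtain w where w: "w \<in> J" "w \<in> frontier G"
      using connected_Int_frontier[of J G] assms(2) \<open>G \<subseteq> J\<close> by blast
    have "closed {y. infdist y (frontier G) = e \<bullet> (y - z)}"
      by (intro closed_Collect_eq continuous_intros)
    then have "closure G \<subseteq> {y. infdist y (frontier G) = e \<bullet> (y - z)}"
      using d by (intro closure_minimal) auto
    then have "infdist w (frontier G) = e \<bullet> (w - z)" using w by (auto simp: frontier_def)
    then show False using w by (simp add: J_def inner_diff_right)
  qed
  ultimately show ?thesis
    unfolding is_half_space_def using assms(4) by (auto simp: J_def intro!: exI[of _ e])
qed

lemma tight_supporting_half_space:
  fixes G :: "'a::euclidean_space set"
  assumes G: "open G" "convex G" and xy: "x \<in> G" "y \<in> G" and z: "z \<in> frontier G"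
    and eq: "(norm (x - z) + norm (z - y))\<^sup>2 =
      (norm (x - y))\<^sup>2 + 4 * infdist x (frontier G) * infdist y (frontier G)"
  obtains a where "norm a = 1" "\<And>w. w \<in> G \<Longrightarrow> a \<bullet> z < a \<bullet> w"
    "infdist x (frontier G) = a \<bullet> (x - z)" "infdist y (frontier G) = a \<bullet> (y - z)"
proof -
  let ?d = "\<lambda>x. infdist x (frontier G)"
  have "z \<in> closure G" "z \<notin> G" "rel_interior G = G"
    using z G(1) by (auto simp: frontier_def interior_open rel_interior_open)
  then obtain a' where a': "a' \<noteq> 0" "\<And>w. w \<in> G \<Longrightarrow> a' \<bullet> z < a' \<bullet> w"
    using supporting_hyperplane_relative_frontier[OF G(2), of z] by metis
  define a where "a = a' /\<^sub>R norm a'"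
  have a: "norm a = 1" using a' by (simp add: a_def)
  have side: "a \<bullet> z < a \<bullet> w" if "w \<in> G" for w
    using a' that by (simp add: a_def divide_strict_right_mono)
  have pos: "0 < ?d w" if "w \<in> G" for w
    using infdist_frontier_pos[OF G(1) _ that] z by auto
  have le: "?d w \<le> a \<bullet> (w - z)" if w: "w \<in> G" for w
  proof -
    \<comment> \<open>The orthogonal projection of \<open>w\<close> to the supporting hyperplane,
      hence a point outside \<open>G\<close>.\<close>
    define p where "p = w - (a \<bullet> (w - z)) *\<^sub>R a"
    have "a \<bullet> p = a \<bullet> z"
      using a by (simp add: p_def inner_diff_right flip: power2_norm_eq_inner)
    then have "p \<notin> G" using side[of p] by auto
    then have "?d w \<le> norm (w - p)" using w by (rule infdist_frontier_le[rotated])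
    also have "\<dots> = a \<bullet> (w - z)" using side[OF w] a by (simp add: p_def inner_diff_right)
    finally show ?thesis .
  qed
  have "(norm (x - y))\<^sup>2 + 4 * (a \<bullet> (x - z)) * (a \<bullet> (y - z)) \<le> (norm (x - z) + norm (y - z))\<^sup>2"
    using reflection_bound[OF a, of "x - z" "y - z"] by simp
  then have prod: "(a \<bullet> (x - z)) * (a \<bullet> (y - z)) \<le> ?d x * ?d y"
    using eq by (simp add: norm_minus_commute)
  \<comment> \<open>Each distance is positive and at most its affine bound, so one strict inequality
    would make the product of the bounds too large for \<open>prod\<close>.\<close>
  have "\<not> ?d x < a \<bullet> (x - z)"
    using mult_less_le_imp_less[of "?d x" "a \<bullet> (x - z)" "?d y" "a \<bullet> (y - z)"] prod
      le[OF xy(2)] pos[OF xy(1)] pos[OF xy(2)] by linarith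
  moreover have "\<not> ?d y < a \<bullet> (y - z)"
    using mult_le_less_imp_less[of "?d x" "a \<bullet> (x - z)" "?d y" "a \<bullet> (y - z)"] prod
      le[OF xy(1)] pos[OF xy(1)] pos[OF xy(2)] by linarith
  ultimately show thesis using that[OF a side] le xy by force
qed

section \<open>Unique nearest points and identification of the domain\<close>

text \<open>The ball about the midpoint through \<open>z\<close> lies in the ball about
  \<open>x\<close> through \<open>z\<close> and touches its sphere only at \<open>z\<close>.\<close>

lemma nearest_point_halfway_unique:
  fixes x z p :: "'a::real_inner"
  assumes "dist x z \<le> dist x p" and "dist (midpoint x z) p \<le> dist (midpoint x z) z"
  shows "p = z"
proof -
  define h where "h = midpoint x z - z"
  define k where "k = midpoint x z - p"
  have "2 *\<^sub>R midpoint x z = x + z" by (simp add: midpoint_def)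
  then have xm: "x - midpoint x z = h"
    by (simp add: h_def scaleR_2 algebra_simps)
  have "norm (h + h) \<le> norm (h + k)"
    using assms(1) unfolding dist_norm xm[symmetric] by (simp add: xm k_def h_def algebra_simps)
  then have "(norm (h + h))\<^sup>2 \<le> (norm (h + k))\<^sup>2" by (rule power_mono) simp
  moreover have "(norm k)\<^sup>2 \<le> (norm h)\<^sup>2"
    using assms(2) by (intro power_mono) (auto simp: h_def k_def dist_norm)
  ultimately have "(norm (h - k))\<^sup>2 \<le> 0"
    by (simp add: power2_norm_eq_inner inner_diff_left inner_diff_right inner_add_left
        inner_add_right inner_commute)
  then show ?thesis by (simp add: h_def k_def)
qed

theorem corollary3p7:
  fixes G :: "(real ^ 'n) set"
  assumes "is_domain G"
    and "G \<noteq> UNIV"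
    and "\<And>x y. x \<in> G \<Longrightarrow> y \<in> G \<Longrightarrow> triangular_ratio G x y = point_pair G x y"
  shows "is_half_space G"
proof -
  let ?F = "frontier G"
  let ?d = "\<lambda>x. infdist x ?F"
  have G: "open G" "connected G" "G \<noteq> {}" using assms(1) by (auto simp: is_domain_def)
  have ne: "?F \<noteq> {}" using G(3) assms(2) by (simp add: frontier_eq_empty)
  note eqD = triangular_ratio_eq_point_pairD[OF assms(3) _ ne]
  have "convex G"
  proof (rule convex_if_infdist_midpoint[OF G(1,2)])
    fix x y assume xy: "x \<in> G" "y \<in> G"
    show "?d x * ?d y \<le> (?d (midpoint x y))\<^sup>2"
    proof (cases "x = y")
      case True
      then show ?thesis by (simp add: power2_eq_square)
    next
      case False
      obtain z where z: "z \<in> ?F" "?d (midpoint x y) = dist (midpoint x y) z"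
        using infdist_attains_inf[of ?F "midpoint x y"] ne by auto
      show ?thesis
        using eqD(1)[OF xy False z(1)] sum_dist_midpoint_bound[of x z y] z(2) by simp
    qed
  qed
  obtain x0 where x0: "x0 \<in> G" using G(3) by auto
  obtain z0 where z0: "z0 \<in> ?F" "?d x0 = dist x0 z0"
    using infdist_attains_inf[of ?F x0] ne by auto
  have d0: "0 < dist x0 z0"
    using x0 z0(1) G(1) by (auto simp: frontier_def interior_open)
  \<comment> \<open>From this halfway point, \<open>z0\<close> is the only nearest boundary point;
    this makes the supporting hyperplane the same for every \<open>y\<close>.\<close>
  define x where "x = midpoint x0 z0"
  have far: "dist x0 z0 \<le> dist x0 p" if "p \<notin> G" for p
    using infdist_frontier_le[OF x0 that] z0(2) by (simp add: dist_norm)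
  have x: "x \<in> G"
  proof (rule ccontr)
    assume "x \<notin> G"
    then show False using far[of x] d0 by (simp add: x_def dist_midpoint)
  qed
  have dx: "?d x \<le> dist x z0" using z0(1) by (rule infdist_le)
  have xz0: "x \<noteq> z0" using d0 by (auto simp: x_def midpoint_eq_endpoint)
  define e where "e = (x - z0) /\<^sub>R norm (x - z0)"
  have tight: "?d x = e \<bullet> (x - z0) \<and> ?d y = e \<bullet> (y - z0)" if y: "y \<in> G" "x \<noteq> y" for y
  proof -
    obtain z where "z \<in> ?F" "(norm (x - z) + norm (z - y))\<^sup>2 = (norm (x - y))\<^sup>2 + 4 * ?d x * ?d y"
      using eqD(2)[OF x y] by auto
    then obtain a where a: "norm a = 1" "\<And>w. w \<in> G \<Longrightarrow> a \<bullet> z < a \<bullet> w"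
        "?d x = a \<bullet> (x - z)" "?d y = a \<bullet> (y - z)"
      using tight_supporting_half_space[OF G(1) \<open>convex G\<close> x y(1)] by blast
    \<comment> \<open>The foot of the perpendicular from \<open>x\<close> to the supporting
      hyperplane at \<open>z\<close>. It lies outside \<open>G\<close> at distance
      \<open>?d x\<close>, so uniqueness identifies it with \<open>z0\<close>, and
      \<open>a = e\<close> follows.\<close>
    define p where "p = x - ?d x *\<^sub>R a"
    have ap: "a \<bullet> p = a \<bullet> z"
      using a(1) by (simp add: p_def a(3) inner_diff_right flip: power2_norm_eq_inner)
    then have "p \<notin> G" using a(2)[of p] by auto
    moreover have xp: "dist x p = ?d x" using a(1) by (simp add: p_def dist_norm infdist_nonneg)
    ultimately have p: "p = z0"
      using nearest_point_halfway_unique[of x0 z0 p] far dx by (simp add: x_def)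
    then have "x - z0 = ?d x *\<^sub>R a" "norm (x - z0) = ?d x"
      using xp by (auto simp: p_def dist_norm)
    moreover from this have "?d x \<noteq> 0" using xz0 by auto
    ultimately have "a = e" unfolding e_def by (metis scaleR_scaleR left_inverse scaleR_one)
    then show ?thesis using a(3,4) ap p by (simp add: inner_diff_right)
  qed
  \<comment> \<open>\<open>tight\<close> gives the formula at \<open>x\<close> itself only through
    another point \<open>y\<close> of \<open>G\<close>, so one has to exist.\<close>
  have "infinite G" using G finite_imp_not_open by blast
  then have "\<not> G \<subseteq> {x}" by (meson finite.intros finite_subset)
  then obtain y where "y \<in> G" "x \<noteq> y" by blast
  then have "?d w = e \<bullet> (w - z0)" if "w \<in> G" for w
    using tight that by (cases "x = w") auto
  moreover have "e \<noteq> 0" using xz0 by (simp add: e_def)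
  ultimately show ?thesis
    by (intro half_space_if_infdist_affine[OF G(1,3) ne])
qed

end
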